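(* For any sufficiently large prime $p$ with $p\equiv\pm1\pmod 8$, there exist a system $\Phi=(\phi_1,\dots,\phi_6)$ of $6$ linear forms $\phi_i\colon\mathbb{F}_p^3\to\mathbb{F}_p$ with true complexity $s(\Phi)=1$, and functions $f_1,\dots,f_6\colon\mathbb{Z}/p\mathbb{Z}\to\mathbb{C}$ with $\|f_i\|_\infty\le1$ for each $i$, such that \[ \left|\Lambda_\Phi(f_1,\dots,f_6)\right|\ge 10^{-12} \] but $\|f_j\|_{U^2}\le p^{-1/8}$ for each $j$.
   Context: Here $\Lambda_\Phi(f_1,\dots,f_6)=\mathbb{E}_{x,y,z\in\mathbb{Z}/p\mathbb{Z}}\prod_{i=1}^6 f_i(\phi_i(x,y,z))$, and $\|f\|_{U^2}^4=\mathbb{E}_{x,h,h'} f(x)\overline{f(x+h)}\,\overline{f(x+h')}f(x+h+h')$. The true complexity $s(\Phi)$ over $\mathbb{F}_p$ is the smallest $s$ such that the symmetric multilinear forms $\phi_1^{\otimes(s+1)},\dots,\phi_6^{\otimes(s+1)}$ are linearly independent; $s(\Phi)=1$ means $\phi_1^{\otimes 2},\dots,\phi_6^{\otimes 2}$ are linearly independent while $\phi_1,\dots,\phi_6$ are not. The system $\Phi$ is allowed to depend on $p$, with no control on its coefficients. *)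

theory Defs
  imports Complex_Main "HOL-Library.FuncSet" "HOL-Library.Extended_Nat" "HOL-Number_Theory.Cong"
begin

text \<open>
  The prime \<open>p\<close> is quantified inside the theorem, so \<open>F\<^sub>p\<close> cannot be a type: it is
  represented by the least non-negative residues.  Functions on \<open>F\<^sub>p\<close> or \<open>F\<^sub>p\<^sup>3\<close> are
  total HOL functions of which only the values on these carriers matter.
\<close>

definition Zp :: "nat \<Rightarrow> int set" where
  "Zp p = {0..<int p}"

definition Zp3 :: "nat \<Rightarrow> (int \<times> int \<times> int) set" where
  "Zp3 p = Zp p \<times> Zp p \<times> Zp p"

definition add3 :: "nat \<Rightarrow> int \<times> int \<times> int \<Rightarrow> int \<times> int \<times> int \<Rightarrow> int \<times> int \<times> int" where
  "add3 p = (\<lambda>(x, y, z) (x', y', z').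
     ((x + x') mod int p, (y + y') mod int p, (z + z') mod int p))"

definition scale3 :: "nat \<Rightarrow> int \<Rightarrow> int \<times> int \<times> int \<Rightarrow> int \<times> int \<times> int" where
  "scale3 p a = (\<lambda>(x, y, z). ((a * x) mod int p, (a * y) mod int p, (a * z) mod int p))"

definition linear_form :: "nat \<Rightarrow> (int \<times> int \<times> int \<Rightarrow> int) \<Rightarrow> bool" where
  "linear_form p \<phi> \<longleftrightarrow>
     \<phi> \<in> Zp3 p \<rightarrow> Zp p \<and>
     (\<forall>u\<in>Zp3 p. \<forall>v\<in>Zp3 p. \<phi> (add3 p u v) = (\<phi> u + \<phi> v) mod int p) \<and>
     (\<forall>a\<in>Zp p. \<forall>v\<in>Zp3 p. \<phi> (scale3 p a v) = (a * \<phi> v) mod int p)"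

text \<open>The tensor power \<open>\<phi>\<^sup>\<otimes>\<^sup>k\<close> as a \<open>k\<close>-linear form on \<open>({..<k} \<rightarrow>\<^sub>E Zp3 p)\<close>, that is on \<open>(F\<^sub>p\<^sup>3)\<^sup>k\<close>.\<close>

definition tensor_power ::
  "nat \<Rightarrow> nat \<Rightarrow> (int \<times> int \<times> int \<Rightarrow> int) \<Rightarrow> (nat \<Rightarrow> int \<times> int \<times> int) \<Rightarrow> int" where
  "tensor_power p k \<phi> v = (\<Prod>j<k. \<phi> (v j)) mod int p"

text \<open>
  Linear independence over \<open>F\<^sub>p\<close> of the family \<open>F 1, \<dots>, F m\<close> of \<open>F\<^sub>p\<close>-valued functions
  on \<open>X\<close>.  It is a property of the family, so repeated members make it dependent.
\<close>

definition lin_indep_mod :: "nat \<Rightarrow> 'a set \<Rightarrow> nat \<Rightarrow> (nat \<Rightarrow> 'a \<Rightarrow> int) \<Rightarrow> bool" where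
  "lin_indep_mod p X m F \<longleftrightarrow>
     (\<forall>c \<in> {1..m} \<rightarrow> Zp p.
        (\<forall>x\<in>X. [(\<Sum>i=1..m. c i * F i x) = 0] (mod int p)) \<longrightarrow> (\<forall>i\<in>{1..m}. c i = 0))"

text \<open>The infimum is taken in \<^typ>\<open>enat\<close>, so the value is \<open>\<infinity>\<close> if no \<open>s\<close> qualifies.\<close>

definition true_complexity :: "nat \<Rightarrow> nat \<Rightarrow> (nat \<Rightarrow> int \<times> int \<times> int \<Rightarrow> int) \<Rightarrow> enat" where
  "true_complexity p m \<phi> =
     (INF s \<in> {s. lin_indep_mod p ({..<s + 1} \<rightarrow>\<^sub>E Zp3 p) m (\<lambda>i. tensor_power p (s + 1) (\<phi> i))}.
        enat s)"

definition form_average ::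
  "nat \<Rightarrow> nat \<Rightarrow> (nat \<Rightarrow> int \<times> int \<times> int \<Rightarrow> int) \<Rightarrow> (nat \<Rightarrow> int \<Rightarrow> complex) \<Rightarrow> complex" where
  "form_average p m \<phi> f =
     (\<Sum>x\<in>Zp p. \<Sum>y\<in>Zp p. \<Sum>z\<in>Zp p. \<Prod>i=1..m. f i (\<phi> i (x, y, z))) / of_nat p ^ 3"

definition U2_average :: "nat \<Rightarrow> (int \<Rightarrow> complex) \<Rightarrow> complex" where
  "U2_average p f =
     (\<Sum>x\<in>Zp p. \<Sum>h\<in>Zp p. \<Sum>h'\<in>Zp p.
        f x * cnj (f ((x + h) mod int p)) * cnj (f ((x + h') mod int p))
          * f ((x + h + h') mod int p)) / of_nat p ^ 3"

text \<open>The average is a non-negative real number, see \<open>U2_norm_power4\<close> below.\<close>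

definition U2_norm :: "nat \<Rightarrow> (int \<Rightarrow> complex) \<Rightarrow> real" where
  "U2_norm p f = root 4 (Re (U2_average p f))"

lemma sum_Zp_shift:
  fixes g :: "int \<Rightarrow> complex"
  shows "(\<Sum>h\<in>Zp p. g ((x + h) mod int p)) = (\<Sum>h\<in>Zp p. g h)"
proof (rule sum.reindex_bij_witness[where i = "\<lambda>y. (y - x) mod int p"
      and j = "\<lambda>h. (x + h) mod int p"])
qed (auto simp: Zp_def mod_simps)

lemma U2_norm_power4: "complex_of_real (U2_norm p f ^ 4) = U2_average p f"
proof -
  define g where "g h x = f x * cnj (f ((x + h) mod int p))" for h x
  define r where "r = (\<Sum>h\<in>Zp p. (cmod (\<Sum>x\<in>Zp p. g h x))\<^sup>2) / real p ^ 3"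
  have summand: "f x * cnj (f ((x + h) mod int p)) * cnj (f ((x + h') mod int p))
          * f ((x + h + h') mod int p) = g h x * cnj (g h ((x + h') mod int p))" for x h h'
    by (simp add: g_def mod_simps algebra_simps)
  have "(\<Sum>x\<in>Zp p. \<Sum>h\<in>Zp p. \<Sum>h'\<in>Zp p. g h x * cnj (g h ((x + h') mod int p)))
      = (\<Sum>h\<in>Zp p. \<Sum>x\<in>Zp p. \<Sum>h'\<in>Zp p. g h x * cnj (g h ((x + h') mod int p)))"
    by (rule sum.swap)
  also have "\<dots> = (\<Sum>h\<in>Zp p. \<Sum>x\<in>Zp p. \<Sum>h'\<in>Zp p. g h x * cnj (g h h'))"
    by (simp add: sum_Zp_shift[where g = "\<lambda>y. cnj (g _ y)"] flip: sum_distrib_left)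
  also have "\<dots> = (\<Sum>h\<in>Zp p. (\<Sum>x\<in>Zp p. g h x) * cnj (\<Sum>x\<in>Zp p. g h x))"
    by (simp add: sum_product)
  also have "\<dots> = (\<Sum>h\<in>Zp p. complex_of_real ((cmod (\<Sum>x\<in>Zp p. g h x))\<^sup>2))"
    by (simp only: complex_norm_square)
  finally have avg: "U2_average p f = complex_of_real r"
    by (simp add: U2_average_def summand r_def)
  have "r \<ge> 0"
    unfolding r_def by (intro divide_nonneg_nonneg sum_nonneg) auto
  then show ?thesis
    by (simp add: U2_norm_def avg)
qed

end

theory Submission
  imports Defs "HOL-Number_Theory.Gauss" "HOL-Library.Product_Plus"
begin

text \<open>
  If \<open>p \<equiv> \<plusminus>1 (mod 8)\<close>, then \<open>2\<close> has a square root \<open>t\<close> mod \<open>p\<close>, and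
  \<open>(a, b) \<mapsto> a + b t\<close> identifies a box of side \<open>\<approx> \<surd>p\<close> in \<open>\<int>[\<surd>2]\<close> with a dense
  subset of \<open>F\<^sub>p\<close> on which additive quadruples lift to \<open>\<int>\<^sup>2\<close>.  On this set the norm
  \<open>N(a, b) = a\<^sup>2 - 2 b\<^sup>2\<close> is a quadratic function which is not a quadratic polynomial mod \<open>p\<close>.
  With coefficients in \<open>\<int>[t]\<close> one finds six forms whose squares are linearly independent although
  \<open>\<Sum>\<^sub>i k\<^sub>i N(\<phi>\<^sub>i) = 0\<close> for nonzero integers \<open>k\<^sub>i\<close>.  The functions \<open>e(c k\<^sub>i N / p)\<close> on boxes
  then cancel exactly in the average over the system, for every \<open>c\<close>.  Averaged over \<open>c\<close>, the fourth
  power of their \<open>U\<^sup>2\<close> norm counts the parallelograms whose sides \<open>h, h'\<close> satisfy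
  \<open>h\<^sub>1 h'\<^sub>1 \<equiv> 2 h\<^sub>2 h'\<^sub>2\<close>; three coordinates determine the fourth, so there are \<open>O(p\<^sup>5\<^sup>/\<^sup>2)\<close> of them,
  and some \<open>c\<close> makes all six norms small at once.
\<close>

section \<open>The square root of 2 modulo p\<close>

text \<open>Gauss's lemma with p = 2h + 1: the doubles 2, 4, ..., 2h are already reduced mod p, and
  h - h div 2 of them exceed h. This number is even because h is 0 or 3 mod 4.\<close>

lemma two_is_square_mod:
  assumes "prime p" "p > 2" and p8: "[int p = 1] (mod 8) \<or> [int p = -1] (mod 8)"
  obtains t :: int where "[t\<^sup>2 = 2] (mod int p)"
proof -
  interpret GAUSS p 2
    using assms by unfold_locales (auto simp: cong_def)
  define h where "h = (int p - 1) div 2"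
  have ph: "int p = 2 * h + 1"
    unfolding h_def by (rule p_eq2)
  have C: "C = (\<lambda>x. x * 2) ` {0<..h}"
    unfolding C_def B_def A_def image_image h_def[symmetric]
    by (rule image_cong) (auto simp: ph)
  have "E = (\<lambda>x. x * 2) ` {h div 2<..h}"
    unfolding E_def C h_def[symmetric] using ph assms(2) by (auto simp: image_iff)
  then have "card E = nat (h - h div 2)"
    by (simp add: card_image inj_on_def)
  moreover have "even (h - h div 2)"
  proof -
    have "8 dvd 2 * h \<or> 8 dvd 2 * h + 2"
      using p8 by (auto simp: ph cong_iff_dvd_diff add_ac)
    then have "h = 4 * (h div 4) \<or> h = 4 * (h div 4) + 3"
      by presburger
    then obtain k where "h = 4 * k \<or> h = 4 * k + 3" ..
    moreover have "(4 * k + 3) div 2 = 2 * k + 1"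
      by linarith
    ultimately show ?thesis by auto
  qed
  ultimately have "Legendre 2 p = 1"
    using gauss_lemma ph assms(2) by (simp add: even_nat_iff)
  then have "QuadRes p 2"
    by (auto simp: Legendre_def split: if_splits)
  then show thesis
    using that by (auto simp: QuadRes_def)
qed

section \<open>Additive characters of F_p\<close>

definition ech :: "nat \<Rightarrow> int \<Rightarrow> complex" where
  "ech p n = cis (2 * pi * of_int n / of_nat p)"

lemma norm_ech [simp]: "cmod (ech p n) = 1"
  by (simp add: ech_def)

lemma ech_0 [simp]: "ech p 0 = 1"
  by (simp add: ech_def)

lemma ech_add: "ech p (m + n) = ech p m * ech p n"
  by (simp add: ech_def cis_mult add_divide_distrib distrib_left)

lemma cnj_ech: "cnj (ech p n) = ech p (- n)"
  by (simp add: ech_def cis_cnj)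

lemma ech_eq_1_iff:
  assumes "p > 0"
  shows "ech p n = 1 \<longleftrightarrow> int p dvd n"
proof -
  have "cis x = 1 \<longleftrightarrow> cos x = 1" for x
    by (auto simp: complex_eq_iff cos_one_sin_zero)
  then have "ech p n = 1 \<longleftrightarrow> (\<exists>m::int. 2 * pi * of_int n / of_nat p = of_int m * (2 * pi))"
    by (simp add: ech_def cos_one_2pi_int mult.assoc)
  also have "\<dots> \<longleftrightarrow> (\<exists>m::int. real_of_int n = real_of_int (int p * m))"
    using assms by (intro ex_cong1) (simp add: field_simps)
  also have "\<dots> \<longleftrightarrow> int p dvd n"
    unfolding of_int_eq_iff dvd_def by simp
  finally show ?thesis .
qed

lemma ech_dvd: "p > 0 \<Longrightarrow> int p dvd n \<Longrightarrow> ech p n = 1"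
  by (simp add: ech_eq_1_iff)

lemma ech_cong:
  assumes "p > 0" "[m = n] (mod int p)"
  shows "ech p m = ech p n"
proof -
  have "ech p m = ech p (m - n) * ech p n"
    by (simp flip: ech_add)
  then show ?thesis
    using assms by (simp add: ech_dvd cong_iff_dvd_diff)
qed

text \<open>Shifting \<open>c\<close> by 1 permutes the residues and multiplies the sum by
  \<open>ech p n\<close>, so the sum vanishes unless that factor is 1.\<close>

lemma sum_ech:
  assumes "p > 0"
  shows "(\<Sum>c\<in>Zp p. ech p (c * n)) = (if int p dvd n then of_nat p else 0)"
proof (cases "int p dvd n")
  case True
  then show ?thesis
    using assms by (simp add: ech_dvd Zp_def)
next
  case False
  have "(\<Sum>c\<in>Zp p. ech p (c * n)) = (\<Sum>c\<in>Zp p. ech p (((1 + c) mod int p) * n))"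
    by (rule sum_Zp_shift[symmetric])
  also have "\<dots> = (\<Sum>c\<in>Zp p. ech p n * ech p (c * n))"
    by (intro sum.cong refl, subst ech_add[symmetric], rule ech_cong[OF assms])
       (simp add: cong_def mod_simps algebra_simps)
  also have "\<dots> = ech p n * (\<Sum>c\<in>Zp p. ech p (c * n))"
    by (simp add: sum_distrib_left)
  finally have "(1 - ech p n) * (\<Sum>c\<in>Zp p. ech p (c * n)) = 0"
    by (simp add: left_diff_distrib)
  with False show ?thesis
    using assms by (auto simp: ech_eq_1_iff)
qed

section \<open>The norm form of Z[sqrt 2] and the zeros of its polar form\<close>

text \<open>If \<open>b\<close> is nonzero, the 2-adic valuation is even on the left and odd on the
  right.\<close>

lemma square_eq_twice_square_int:
  fixes a b :: int
  assumes "a\<^sup>2 = 2 * b\<^sup>2"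
  shows "a = 0 \<and> b = 0"
proof (cases "b = 0")
  case False
  then have "a \<noteq> 0" using assms by auto
  have "2 * multiplicity 2 a = multiplicity 2 (a\<^sup>2)"
    using \<open>a \<noteq> 0\<close> by (simp add: prime_elem_multiplicity_power_distrib)
  also have "\<dots> = Suc (2 * multiplicity 2 b)"
    using False by (simp add: assms prime_elem_multiplicity_mult_distrib
      prime_elem_multiplicity_power_distrib)
  finally show ?thesis by presburger
qed (use assms in auto)

definition nrm :: "int \<times> int \<Rightarrow> int" where
  "nrm P = (fst P)\<^sup>2 - 2 * (snd P)\<^sup>2"

text \<open>The polar form of \<open>nrm\<close>:
  \<open>nrm (P + Q) = nrm P + 2 * bil P Q + nrm Q\<close>.\<close>

definition bil :: "int \<times> int \<Rightarrow> int \<times> int \<Rightarrow> int" where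
  "bil P Q = fst P * fst Q - 2 * (snd P * snd Q)"

definition box :: "nat \<Rightarrow> (int \<times> int) set" where
  "box L = {- int L..int L} \<times> {- int L..int L}"

lemma finite_box [simp]: "finite (box L)"
  by (simp add: box_def)

lemma card_symmetric_interval: "card {- int L..int L} = 2 * L + 1"
proof -
  have "card {- int L..int L} = nat (2 * int L + 1)" by simp
  then show ?thesis by linarith
qed

lemma card_box: "card (box L) = (2 * L + 1)\<^sup>2"
  by (simp only: box_def card_cartesian_product power2_eq_square card_symmetric_interval)

text \<open>The square term pays for P = 0, where Q is arbitrary. For P nonzero, some coordinate of
  P is invertible mod p, so the congruence fixes one coordinate of Q mod p, and hence exactly, since
  two candidates differ by at most 2M < p.\<close>

lemma card_bil_zeros:
  assumes p: "prime p" "p > 2" and M: "2 * M < p"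
  shows "card {(P, Q). P \<in> box M \<and> Q \<in> box M \<and> int p dvd bil P Q}
    \<le> (2 * M + 1) ^ 2 + (2 * M + 1) ^ 3" (is "card ?Z \<le> _")
proof -
  define Z' where "Z' = {(P, Q). P \<in> box M \<and> Q \<in> box M \<and> int p dvd bil P Q \<and> P \<noteq> (0, 0)}"
  \<comment> \<open>Besides P, keep the coordinate of Q that is free: if \<open>fst P\<close> is
    nonzero, the congruence recovers \<open>fst Q\<close>, otherwise it recovers
    \<open>snd Q\<close>.\<close>
  define g where "g = (\<lambda>(P :: int \<times> int, Q :: int \<times> int). (P, if fst P \<noteq> 0 then snd Q else fst Q))"
  have pp: "prime (int p)" using p by simp
  have small: "x = 0" if "int p dvd x" "\<bar>x\<bar> \<le> 2 * int M" for x
    using that M dvd_imp_le_int[of x "int p"] by fastforce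
  have inj: "inj_on g Z'"
  proof (rule inj_onI)
    fix u v assume u: "u \<in> Z'" and v: "v \<in> Z'" and eq: "g u = g v"
    obtain a b a' b' where u': "u = ((a, b), (a', b'))" by (metis surj_pair)
    obtain c d c' d' where v': "v = ((c, d), (c', d'))" by (metis surj_pair)
    have [simp]: "c = a" "d = b"
      using eq by (auto simp: u' v' g_def)
    have "int p dvd bil (a, b) (a', b')" "int p dvd bil (a, b) (c', d')"
      using u v by (auto simp: u' v' Z'_def)
    from dvd_diff[OF this] have d: "int p dvd a * (a' - c') - 2 * (b * (b' - d'))"
      by (simp add: bil_def algebra_simps)
    have bounds: "\<bar>a\<bar> \<le> M" "\<bar>b\<bar> \<le> M" "\<bar>a'-c'\<bar> \<le> 2 * int M" "\<bar>b'-d'\<bar> \<le> 2 * int M"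
      using u v by (auto simp: u' v' Z'_def box_def abs_le_iff)
    show "u = v"
    proof (cases "a = 0")
      case False
      with eq have "b' = d'" by (simp add: u' v' g_def)
      with d have "int p dvd a \<or> int p dvd a' - c'"
        using pp by (simp add: prime_dvd_mult_iff)
      then have "a' = c'" using small[of a] small[of "a' - c'"] bounds False by auto
      with \<open>b' = d'\<close> show ?thesis by (simp add: u' v')
    next
      case True
      with eq have "a' = c'" by (simp add: u' v' g_def)
      have "b \<noteq> 0" using u True by (simp add: u' Z'_def)
      have "\<not> int p dvd 2" using p by (auto dest: zdvd_imp_le)
      with d True have "int p dvd b \<or> int p dvd b' - d'"
        using pp by (simp add: prime_dvd_mult_iff)
      then have "b' = d'" using small[of b] small[of "b' - d'"] bounds \<open>b \<noteq> 0\<close> by auto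
      with \<open>a' = c'\<close> show ?thesis by (simp add: u' v')
    qed
  qed
  have "g ` Z' \<subseteq> box M \<times> {- int M..int M}"
    by (auto simp: g_def Z'_def box_def split: if_splits)
  then have "card Z' \<le> card (box M \<times> {- int M..int M})"
    using inj by (intro card_inj_on_le) auto
  also have "\<dots> = (2 * M + 1) ^ 3"
    by (simp only: card_cartesian_product card_box card_symmetric_interval
      power2_eq_square power3_eq_cube)
  finally have Z': "card Z' \<le> (2 * M + 1) ^ 3" .
  have fin: "finite ({(0, 0)} \<times> box M \<union> Z')"
    by (rule finite_subset[of _ "{(0, 0)} \<times> box M \<union> box M \<times> box M"]) (auto simp: Z'_def)
  have "card ?Z \<le> card ({(0, 0)} \<times> box M \<union> Z')"
    by (rule card_mono[OF fin]) (auto simp: Z'_def)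
  also have "\<dots> \<le> card ({(0 :: int, 0 :: int)} \<times> box M) + card Z'"
    by (rule card_Un_le)
  also have "\<dots> \<le> (2 * M + 1) ^ 2 + (2 * M + 1) ^ 3"
    using Z' by (simp add: card_cartesian_product card_box)
  finally show ?thesis .
qed

lemma sum_move_innermost:
  fixes g :: "_ \<Rightarrow> _ \<Rightarrow> _ \<Rightarrow> _ \<Rightarrow> 'a :: comm_monoid_add"
  shows "(\<Sum>c\<in>A. \<Sum>x\<in>B. \<Sum>h\<in>C. \<Sum>k\<in>D. g c x h k) = (\<Sum>x\<in>B. \<Sum>h\<in>C. \<Sum>k\<in>D. \<Sum>c\<in>A. g c x h k)"
proof -
  have "(\<Sum>c\<in>A. \<Sum>x\<in>B. \<Sum>h\<in>C. \<Sum>k\<in>D. g c x h k) = (\<Sum>x\<in>B. \<Sum>c\<in>A. \<Sum>h\<in>C. \<Sum>k\<in>D. g c x h k)"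
    by (rule sum.swap)
  also have "\<dots> = (\<Sum>x\<in>B. \<Sum>h\<in>C. \<Sum>c\<in>A. \<Sum>k\<in>D. g c x h k)"
    by (rule sum.cong[OF refl], rule sum.swap)
  also have "\<dots> = (\<Sum>x\<in>B. \<Sum>h\<in>C. \<Sum>k\<in>D. \<Sum>c\<in>A. g c x h k)"
    by (rule sum.cong[OF refl], rule sum.cong[OF refl], rule sum.swap)
  finally show ?thesis .
qed

lemma interval_1_6:
  "{1..6::nat} = {1, 2, 3, 4, 5, 6}" "{Suc 0..6::nat} = {1, 2, 3, 4, 5, 6}"
  by auto

definition dot :: "int \<times> int \<times> int \<Rightarrow> int \<times> int \<times> int \<Rightarrow> int" where
  "dot = (\<lambda>(a, b, c) (x, y, z). a * x + b * y + c * z)"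

lemma dot_mod: "dot u (x mod n, y mod n, z mod n) mod n = dot u (x, y, z) mod n"
proof -
  have "[dot u (x mod n, y mod n, z mod n) = dot u (x, y, z)] (mod n)"
    by (cases u) (auto simp: dot_def intro!: cong_add cong_mult)
  then show ?thesis by (simp add: cong_def)
qed

section \<open>Lifting from F_p to boxes in Z[sqrt 2]\<close>

locale sqrt2_mod =
  fixes p :: nat and t :: int
  assumes prime_p: "prime p" and p_gt_2: "p > 2" and t_square: "[t\<^sup>2 = 2] (mod int p)"
begin

lemma p_pos [simp]: "p > 0"
  using p_gt_2 by simp

lemma p_nonzero [simp]: "p \<noteq> 0"
  using p_gt_2 by simp

lemma not_dvd_2: "\<not> int p dvd 2"
  using p_gt_2 by (auto dest: zdvd_imp_le)

definition emb :: "int \<times> int \<Rightarrow> int" where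
  "emb P = (fst P + snd P * t) mod int p"

lemma emb_in_Zp [simp]: "emb P \<in> Zp p"
  by (simp add: emb_def Zp_def)

lemma small_emb_zero:
  assumes "[a + b * t = 0] (mod int p)" "\<bar>a\<bar> \<le> M" "\<bar>b\<bar> \<le> M" "2 * M\<^sup>2 < int p"
  shows "a = 0 \<and> b = 0"
proof -
  \<comment> \<open>The norm of \<open>a + b \<surd>2\<close> is divisible by \<open>p\<close> but smaller than \<open>p\<close>, and \<open>\<surd>2\<close> is irrational.\<close>
  have "int p dvd (a + b * t) * (a - b * t) + b\<^sup>2 * (t\<^sup>2 - 2)"
    using assms(1) t_square by (intro dvd_add) (auto simp: cong_0_iff cong_iff_dvd_diff)
  then have dvd: "int p dvd a\<^sup>2 - 2 * b\<^sup>2"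
    by (simp add: algebra_simps power2_eq_square)
  have "a\<^sup>2 \<le> M\<^sup>2" "b\<^sup>2 \<le> M\<^sup>2"
    using assms(2,3) by (auto simp: abs_le_square_iff[symmetric])
  then have "\<bar>a\<^sup>2 - 2 * b\<^sup>2\<bar> < int p"
    using assms(4) zero_le_power2[of a] zero_le_power2[of b] by linarith
  then have "a\<^sup>2 = 2 * b\<^sup>2"
    using dvd dvd_imp_le_int[of "a\<^sup>2 - 2 * b\<^sup>2" "int p"] by fastforce
  then show ?thesis
    by (rule square_eq_twice_square_int)
qed

definition coord :: "nat \<Rightarrow> int \<Rightarrow> int \<times> int" where
  "coord L = inv_into (box L) emb"

lemma coord_in_box: "x \<in> emb ` box L \<Longrightarrow> coord L x \<in> box L"
  unfolding coord_def by (rule inv_into_into)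

lemma emb_coord: "x \<in> emb ` box L \<Longrightarrow> emb (coord L x) = x"
  unfolding coord_def by (rule f_inv_into_f)

lemma inj_on_emb:
  assumes "32 * L\<^sup>2 < p"
  shows "inj_on emb (box L)"
proof (rule inj_onI)
  fix P Q assume PQ: "P \<in> box L" "Q \<in> box L" and "emb P = emb Q"
  then have "[(fst P - fst Q) + (snd P - snd Q) * t = 0] (mod int p)"
    by (simp add: emb_def cong_0_iff mod_eq_dvd_iff algebra_simps)
  moreover have "2 * (4 * int L)\<^sup>2 < int p"
    using assms by (simp add: power_mult_distrib flip: of_nat_power)
  ultimately show "P = Q"
    using small_emb_zero[of "fst P - fst Q" "snd P - snd Q" "4 * int L"] PQ
    by (auto simp: box_def prod_eq_iff)
qed

lemma coord_emb: "32 * L\<^sup>2 < p \<Longrightarrow> P \<in> box L \<Longrightarrow> coord L (emb P) = P"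
  unfolding coord_def by (intro inv_into_f_f inj_on_emb)

lemma cong_coord:
  "x \<in> emb ` box L \<Longrightarrow> [fst (coord L x) + snd (coord L x) * t = x] (mod int p)"
  using emb_coord[of x L] by (auto simp: emb_def cong_def)

text \<open>The box is Freiman isomorphic of order 2 to its image. The alternating sum of four
  coordinates has size at most 4L, and 32 L^2 = 2 (4L)^2 is the bound that
  \<open>small_emb_zero\<close> asks for.\<close>

lemma coord_parallelogram:
  assumes L: "32 * L\<^sup>2 < p"
    and mem: "x0 \<in> emb ` box L" "x1 \<in> emb ` box L" "x2 \<in> emb ` box L" "x3 \<in> emb ` box L"
    and eq: "[x0 + x3 = x1 + x2] (mod int p)"
  shows "coord L x3 = coord L x1 + coord L x2 - coord L x0"
proof -
  let ?a = "\<lambda>i. fst (coord L i)" and ?b = "\<lambda>i. snd (coord L i)"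
  have "[(?a x0 + ?b x0 * t) + (?a x3 + ?b x3 * t) - ((?a x1 + ?b x1 * t) + (?a x2 + ?b x2 * t))
      = x0 + x3 - (x1 + x2)] (mod int p)"
    by (intro cong_add cong_diff cong_coord mem)
  also have "[x0 + x3 - (x1 + x2) = 0] (mod int p)"
    using eq by (simp add: cong_0_iff cong_iff_dvd_diff)
  finally have "[(?a x0 + ?a x3 - ?a x1 - ?a x2) + (?b x0 + ?b x3 - ?b x1 - ?b x2) * t = 0] (mod int p)"
    by (simp add: algebra_simps)
  moreover have "2 * (4 * int L)\<^sup>2 < int p"
    using L by (simp add: power_mult_distrib flip: of_nat_power)
  moreover
  have "coord L x0 \<in> box L" "coord L x1 \<in> box L" "coord L x2 \<in> box L" "coord L x3 \<in> box L"
    using mem by (auto intro: coord_in_box)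
  then have "\<bar>?a x0 + ?a x3 - ?a x1 - ?a x2\<bar> \<le> 4 * int L" "\<bar>?b x0 + ?b x3 - ?b x1 - ?b x2\<bar> \<le> 4 * int L"
    by (auto simp: box_def mem_Times_iff)
  ultimately have "?a x0 + ?a x3 - ?a x1 - ?a x2 = 0 \<and> ?b x0 + ?b x3 - ?b x1 - ?b x2 = 0"
    by (intro small_emb_zero)
  then show ?thesis
    by (simp add: prod_eq_iff)
qed

section \<open>Quadratic phases and their U^2 averages\<close>

text \<open>The two factors are kept apart because \<open>k\<close> belongs to one form of the
  system while \<open>c\<close> is a common frequency to be averaged over.\<close>

definition phase :: "nat \<Rightarrow> int \<Rightarrow> int \<Rightarrow> int \<Rightarrow> complex" where
  "phase L k c x = (if x \<in> emb ` box L then ech p (c * (k * nrm (coord L x))) else 0)"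

lemma norm_phase: "cmod (phase L k c x) \<le> 1"
  by (simp add: phase_def)

lemma phase_emb:
  "32 * L\<^sup>2 < p \<Longrightarrow> P \<in> box L \<Longrightarrow> phase L k c (emb P) = ech p (c * (k * nrm P))"
  by (simp add: phase_def coord_emb)

text \<open>The parallelograms in the image of the box that survive averaging over the frequency: up
  to a factor 2, the last condition says that the second difference of the norm vanishes mod
  p.\<close>

definition derivs :: "nat \<Rightarrow> (int \<times> int \<times> int) set" where
  "derivs L = {(x, h, h'). x \<in> Zp p \<and> h \<in> Zp p \<and> h' \<in> Zp p \<and>
     x \<in> emb ` box L \<and> (x + h) mod int p \<in> emb ` box L \<and> (x + h') mod int p \<in> emb ` box L \<and>
     (x + h + h') mod int p \<in> emb ` box L \<and>
     int p dvd bil (coord L ((x + h) mod int p) - coord L x) (coord L ((x + h') mod int p) - coord L x)}"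

lemma sum_phase_parallelogram:
  assumes L: "32 * L\<^sup>2 < p" and k: "\<not> int p dvd k" and xh: "x \<in> Zp p" "h \<in> Zp p" "h' \<in> Zp p"
  shows "(\<Sum>c\<in>Zp p. phase L k c x * cnj (phase L k c ((x + h) mod int p))
      * cnj (phase L k c ((x + h') mod int p)) * phase L k c ((x + h + h') mod int p))
    = (if (x, h, h') \<in> derivs L then of_nat p else 0)"
proof (cases "x \<in> emb ` box L \<and> (x + h) mod int p \<in> emb ` box L \<and>
    (x + h') mod int p \<in> emb ` box L \<and> (x + h + h') mod int p \<in> emb ` box L")
  case True
  define P where "P = coord L x"
  define P1 where "P1 = coord L ((x + h) mod int p)"
  define P2 where "P2 = coord L ((x + h') mod int p)"
  have P3: "coord L ((x + h + h') mod int p) = P1 + P2 - P"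
    unfolding P_def P1_def P2_def
  proof (rule coord_parallelogram[OF L])
    show "[x + (x + h + h') mod int p = (x + h) mod int p + (x + h') mod int p] (mod int p)"
      by (simp only: cong_def mod_add_left_eq mod_add_right_eq) (simp add: add_ac)
  qed (use True in blast)+
  \<comment> \<open>The lifts form a parallelogram in Z^2, and the alternating sum of a quadratic
    form over its corners is twice the polar form of the sides.\<close>
  have "phase L k c x * cnj (phase L k c ((x + h) mod int p))
      * cnj (phase L k c ((x + h') mod int p)) * phase L k c ((x + h + h') mod int p)
    = ech p (c * (2 * k * bil (P1 - P) (P2 - P)))" for c
    using True
    by (simp add: phase_def P3 flip: P_def P1_def P2_def)
       (simp add: cnj_ech nrm_def bil_def algebra_simps power2_eq_square flip: ech_add)
  moreover have "int p dvd 2 * k * bil (P1 - P) (P2 - P) \<longleftrightarrow> int p dvd bil (P1 - P) (P2 - P)"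
    using prime_p k not_dvd_2 by (simp add: prime_dvd_mult_iff)
  ultimately show ?thesis
    using True xh by (simp add: sum_ech derivs_def P_def P1_def P2_def)
qed (auto simp: phase_def derivs_def)

lemma sum_U2_average_phase:
  assumes "32 * L\<^sup>2 < p" "\<not> int p dvd k"
  shows "(\<Sum>c\<in>Zp p. U2_average p (phase L k c)) = of_nat (card (derivs L)) / of_nat p ^ 2"
proof -
  have "(\<Sum>c\<in>Zp p. U2_average p (phase L k c)) * of_nat p ^ 3
    = (\<Sum>c\<in>Zp p. \<Sum>x\<in>Zp p. \<Sum>h\<in>Zp p. \<Sum>h'\<in>Zp p. phase L k c x * cnj (phase L k c ((x + h) mod int p))
      * cnj (phase L k c ((x + h') mod int p)) * phase L k c ((x + h + h') mod int p))"
    by (simp add: U2_average_def flip: sum_divide_distrib)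
  also have "\<dots> = (\<Sum>x\<in>Zp p. \<Sum>h\<in>Zp p. \<Sum>h'\<in>Zp p. \<Sum>c\<in>Zp p. phase L k c x * cnj (phase L k c ((x + h) mod int p))
      * cnj (phase L k c ((x + h') mod int p)) * phase L k c ((x + h + h') mod int p))"
    by (rule sum_move_innermost)
  also have "\<dots> = (\<Sum>x\<in>Zp p. \<Sum>h\<in>Zp p. \<Sum>h'\<in>Zp p. if (x, h, h') \<in> derivs L then of_nat p else 0)"
    using assms by (intro sum.cong refl sum_phase_parallelogram)
  also have "\<dots> = (\<Sum>u\<in>Zp p \<times> Zp p \<times> Zp p. if u \<in> derivs L then of_nat p else 0)"
    by (simp add: sum.cartesian_product case_prod_unfold)
  also have "\<dots> = (\<Sum>u\<in>derivs L. of_nat p)"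
    by (rule sum.mono_neutral_cong_right) (auto simp: derivs_def Zp_def)
  finally show ?thesis
    by (simp add: field_simps power2_eq_square power3_eq_cube)
qed

text \<open>A triple is determined by the lift of its base point and the lifts of its two sides.
  Sides are differences of box points, hence lie in the box of radius 2L, where
  \<open>card_bil_zeros\<close> applies.\<close>

lemma card_derivs:
  assumes L: "32 * L\<^sup>2 < p"
  shows "card (derivs L) \<le> (2 * L + 1) ^ 2 * ((4 * L + 1) ^ 2 + (4 * L + 1) ^ 3)"
proof -
  let ?Z = "{(P, Q). P \<in> box (2 * L) \<and> Q \<in> box (2 * L) \<and> int p dvd bil P Q}"
  define g where "g = (\<lambda>(x, h, h'). (coord L x, coord L ((x + h) mod int p) - coord L x,
    coord L ((x + h') mod int p) - coord L x))"
  have "inj_on g (derivs L)"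
  proof (rule inj_onI)
    fix u v assume u: "u \<in> derivs L" and v: "v \<in> derivs L" and eq: "g u = g v"
    obtain x h h' where u': "u = (x, h, h')" by (metis surj_pair)
    obtain y j j' where v': "v = (y, j, j')" by (metis surj_pair)
    have inj: "a = b" if "a \<in> emb ` box L" "b \<in> emb ` box L" "coord L a = coord L b" for a b
      using that emb_coord by metis
    have "x = y"
      using eq u v by (intro inj) (auto simp: u' v' g_def derivs_def)
    moreover have "(x + h) mod int p = (y + j) mod int p" "(x + h') mod int p = (y + j') mod int p"
      using eq u v by (auto simp: u' v' g_def derivs_def intro!: inj)
    ultimately have "[h = j] (mod int p)" "[h' = j'] (mod int p)"
      by (auto simp flip: cong_def simp: cong_add_lcancel)
    with u v have "h = j" "h' = j'"
      by (auto simp: u' v' derivs_def Zp_def cong_def)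
    with \<open>x = y\<close> show "u = v" by (simp add: u' v')
  qed
  moreover have "g ` derivs L \<subseteq> box L \<times> ?Z"
  proof (rule image_subsetI)
    fix u assume u: "u \<in> derivs L"
    obtain x h h' where u': "u = (x, h, h')" by (metis surj_pair)
    have "coord L x \<in> box L" "coord L ((x + h) mod int p) \<in> box L" "coord L ((x + h') mod int p) \<in> box L"
      using u unfolding u' derivs_def by (blast intro: coord_in_box)+
    then have "coord L ((x + h) mod int p) - coord L x \<in> box (2 * L)"
        "coord L ((x + h') mod int p) - coord L x \<in> box (2 * L)"
      by (auto simp: box_def mem_Times_iff)
    with \<open>coord L x \<in> box L\<close> u show "g u \<in> box L \<times> ?Z"
      by (simp add: u' g_def derivs_def)
  qed
  moreover have finZ: "finite ?Z"
    by (rule finite_subset[of _ "box (2 * L) \<times> box (2 * L)"]) auto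
  ultimately have "card (derivs L) \<le> card (box L \<times> ?Z)"
    by (intro card_inj_on_le) auto
  also have "\<dots> = (2 * L + 1) ^ 2 * card ?Z"
    by (simp add: card_cartesian_product card_box)
  also have "\<dots> \<le> (2 * L + 1) ^ 2 * ((2 * (2 * L) + 1) ^ 2 + (2 * (2 * L) + 1) ^ 3)"
  proof (rule mult_left_mono, rule card_bil_zeros[OF prime_p p_gt_2])
    have "L \<le> L\<^sup>2" by (simp add: power2_eq_square)
    then show "2 * (2 * L) < p" using L by linarith
  qed simp
  finally show ?thesis
    by (simp only: mult.assoc[symmetric]) simp
qed

section \<open>The six forms and their true complexity\<close>

text \<open>Read t as sqrt 2 and write w' for the conjugate of w. For the rows (a, b, c) of forms 4,
  5, 6 with signs +, +, -, the sums of a b', a c' and b c' all vanish, so the signed sum of their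
  norms has no cross terms. Without conjugation no nontrivial combination of the three rows cancels
  all cross terms mod p.\<close>

definition coef :: "nat \<Rightarrow> int \<times> int \<times> int" where
  "coef i = (if i = 1 then (1, 0, 0) else if i = 2 then (0, 1, 0) else if i = 3 then (0, 0, 1)
    else if i = 4 then (1, 1, 1) else if i = 5 then (1, 1 + t, t - 1) else (1, 2 + t, t))"

definition sys :: "nat \<Rightarrow> int \<times> int \<times> int \<Rightarrow> int" where
  "sys i v = dot (coef i) v mod int p"

lemma linear_form_sys: "linear_form p (sys i)"
  unfolding linear_form_def
proof (intro conjI ballI)
  obtain a b c where coef: "coef i = (a, b, c)" by (metis surj_pair)
  fix u v assume "u \<in> Zp3 p" "v \<in> Zp3 p"
  obtain x y z where u: "u = (x, y, z)" by (metis surj_pair)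
  obtain x' y' z' where v: "v = (x', y', z')" by (metis surj_pair)
  have "sys i (add3 p u v) = dot (coef i) (x + x', y + y', z + z') mod int p"
    by (simp add: sys_def add3_def u v dot_mod)
  also have "\<dots> = (dot (coef i) u + dot (coef i) v) mod int p"
    by (simp add: coef u v dot_def algebra_simps)
  finally show "sys i (add3 p u v) = (sys i u + sys i v) mod int p"
    by (simp add: sys_def mod_simps)
next
  obtain a b c where coef: "coef i = (a, b, c)" by (metis surj_pair)
  fix r v assume "r \<in> Zp p" "v \<in> Zp3 p"
  obtain x y z where v: "v = (x, y, z)" by (metis surj_pair)
  have "sys i (scale3 p r v) = dot (coef i) (r * x, r * y, r * z) mod int p"
    by (simp add: sys_def scale3_def v dot_mod)
  also have "\<dots> = (r * dot (coef i) v) mod int p"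
    by (simp add: coef v dot_def algebra_simps)
  finally show "sys i (scale3 p r v) = (r * sys i v) mod int p"
    by (simp add: sys_def mod_simps)
qed (auto simp: sys_def Zp_def)

lemma sys_dependent:
  "\<not> lin_indep_mod p ({..<0 + 1} \<rightarrow>\<^sub>E Zp3 p) 6 (\<lambda>i. tensor_power p (0 + 1) (sys i))"
proof
  assume *: "lin_indep_mod p ({..<0 + 1} \<rightarrow>\<^sub>E Zp3 p) 6 (\<lambda>i. tensor_power p (0 + 1) (sys i))"
  \<comment> \<open>The fourth form is the sum of the first three; \<open>int p - 1\<close> is the
    representative of -1 in \<open>Zp p\<close>.\<close>
  define c :: "nat \<Rightarrow> int" where "c = (\<lambda>i. if i \<le> 3 then 1 else if i = 4 then int p - 1 else 0)"
  have "[(\<Sum>i=1..6. c i * tensor_power p (0 + 1) (sys i) v) = 0] (mod int p)" for v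
  proof -
    have "[(\<Sum>i=1..6. c i * tensor_power p (0 + 1) (sys i) v)
      = (\<Sum>i=1..6. c i * dot (coef i) (v 0))] (mod int p)"
      by (intro cong_sum cong_mult cong_refl) (simp add: cong_def tensor_power_def sys_def)
    also have "(\<Sum>i=1..6. c i * dot (coef i) (v 0)) = int p * dot (1, 1, 1) (v 0)"
      by (simp add: c_def interval_1_6 coef_def dot_def algebra_simps split: prod.splits)
    also have "[int p * dot (1, 1, 1) (v 0) = 0] (mod int p)" by (simp add: cong_0_iff)
    finally show ?thesis .
  qed
  moreover have "c \<in> {1..6} \<rightarrow> Zp p"
    using p_gt_2 by (auto simp: c_def Zp_def)
  ultimately have "\<forall>i\<in>{1..6}. c i = 0"
    using * unfolding lin_indep_mod_def by blast
  then have "c 1 = 0" by simp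
  then show False by (simp add: c_def)
qed

text \<open>Evaluation at pairs of basis vectors gives six congruences. The three mixed ones involve
  only \<open>c 4\<close>, \<open>c 5\<close>, \<open>c 6\<close> and force these to vanish, because
  2 and t are invertible; the diagonal ones then give the other three.\<close>

lemma squares_independent:
  "lin_indep_mod p ({..<1 + 1} \<rightarrow>\<^sub>E Zp3 p) 6 (\<lambda>i. tensor_power p (1 + 1) (sys i))"
  unfolding lin_indep_mod_def
proof (intro ballI impI)
  fix c :: "nat \<Rightarrow> int" and i :: nat
  assume c: "c \<in> {1..6} \<rightarrow> Zp p" and i: "i \<in> {1..6}"
    and eq: "\<forall>v\<in>{..<1 + 1} \<rightarrow>\<^sub>E Zp3 p. [(\<Sum>i=1..6. c i * tensor_power p (1 + 1) (sys i) v) = 0] (mod int p)"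
  have pair: "int p dvd (\<Sum>i=1..6. c i * (dot (coef i) u * dot (coef i) w))"
    if "u \<in> Zp3 p" "w \<in> Zp3 p" for u w
  proof -
    define v where "v = (\<lambda>j::nat. if j = 0 then u else if j = 1 then w else undefined)"
    have v: "v \<in> {..<1 + 1} \<rightarrow>\<^sub>E Zp3 p"
      using that by (auto simp: v_def PiE_def extensional_def)
    have "[(\<Sum>i=1..6. c i * (dot (coef i) u * dot (coef i) w))
      = (\<Sum>i=1..6. c i * tensor_power p (1 + 1) (sys i) v)] (mod int p)"
      by (intro cong_sum cong_mult cong_refl)
        (simp add: cong_def tensor_power_def sys_def lessThan_Suc v_def mod_mult_eq mult.commute)
    also have "[(\<Sum>i=1..6. c i * tensor_power p (1 + 1) (sys i) v) = 0] (mod int p)"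
      using eq v by blast
    finally show ?thesis
      by (simp only: cong_0_iff)
  qed
  have basis: "(1, 0, 0) \<in> Zp3 p" "(0, 1, 0) \<in> Zp3 p" "(0, 0, 1) \<in> Zp3 p"
    using p_gt_2 by (auto simp: Zp3_def Zp_def)
  note simps = interval_1_6 coef_def dot_def add_ac
  have xx: "int p dvd c 1 + (c 4 + (c 5 + c 6))"
    using pair[OF basis(1,1)] by (simp add: simps)
  have yy: "int p dvd c 2 + (c 4 + (c 5 * ((1 + t) * (1 + t)) + c 6 * ((2 + t) * (2 + t))))"
    using pair[OF basis(2,2)] by (simp add: simps)
  have zz: "int p dvd c 3 + (c 4 + (c 5 * ((t - 1) * (t - 1)) + c 6 * (t * t)))"
    using pair[OF basis(3,3)] by (simp add: simps)
  have xy: "int p dvd c 4 + (c 5 * (1 + t) + c 6 * (2 + t))"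
    using pair[OF basis(1,2)] by (simp add: simps)
  have xz: "int p dvd c 4 + (c 5 * (t - 1) + c 6 * t)"
    using pair[OF basis(1,3)] by (simp add: simps)
  have yz: "int p dvd c 4 + (c 5 * ((1 + t) * (t - 1)) + c 6 * ((2 + t) * t))"
    using pair[OF basis(2,3)] by (simp add: simps)
  have pp: "prime (int p)" using prime_p by simp
  have ndvd_t: "\<not> int p dvd t"
  proof
    assume "int p dvd t"
    then have "int p dvd t\<^sup>2" by (simp add: power2_eq_square)
    moreover have "int p dvd t\<^sup>2 - 2" using t_square by (simp add: cong_iff_dvd_diff)
    ultimately have "int p dvd t\<^sup>2 - (t\<^sup>2 - 2)" by (rule dvd_diff)
    then show False using not_dvd_2 by simp
  qed
  have "int p dvd 2 * (c 5 + c 6)"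
    using dvd_diff[OF xy xz] by (simp add: algebra_simps)
  then have s56: "int p dvd c 5 + c 6"
    using not_dvd_2 prime_dvd_multD[OF pp, of 2 "c 5 + c 6"] by simp
  have s46: "int p dvd c 4 + c 6"
    using dvd_diff[OF xy dvd_mult[OF s56, of "1 + t"]] by (simp add: algebra_simps)
  \<comment> \<open>Subtracting \<open>c 4 + c 6\<close> and (t^2 - 1)(\<open>c 5 + c 6\<close>)
    from the yz congruence leaves 2t \<open>c 6\<close>.\<close>
  have "int p dvd 2 * (t * c 6)"
    using dvd_diff[OF dvd_diff[OF yz s46] dvd_mult[OF s56, of "(1 + t) * (t - 1)"]]
    by (simp add: algebra_simps)
  then have c6: "int p dvd c 6"
    using pp not_dvd_2 ndvd_t by (simp add: prime_dvd_mult_iff)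
  then have c45: "int p dvd c 5" "int p dvd c 4"
    using s56 s46 by (simp_all add: dvd_add_left_iff[OF c6])
  then have rest: "int p dvd c 4 + (c 5 * x + c 6 * y)" for x y
    using c6 by simp
  have "int p dvd c 1" "int p dvd c 2" "int p dvd c 3"
    using xx yy zz by (simp_all only: dvd_add_left_iff[OF rest] dvd_add_left_iff[OF rest[of 1 1, simplified]])
  with c45 c6 have "int p dvd c i"
    using i by (auto simp: interval_1_6)
  moreover have "c i \<in> Zp p" using c i by blast
  ultimately show "c i = 0"
    by (auto simp: Zp_def dest: zdvd_imp_le)
qed

lemma true_complexity_sys: "true_complexity p 6 sys = 1"
proof (rule antisym)
  show "true_complexity p 6 sys \<le> 1"
    unfolding true_complexity_def one_enat_def
    by (rule INF_lower, rule CollectI, rule squares_independent)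
  show "1 \<le> true_complexity p 6 sys"
    unfolding true_complexity_def
  proof (rule INF_greatest)
    fix s assume s: "s \<in> {s. lin_indep_mod p ({..<s + 1} \<rightarrow>\<^sub>E Zp3 p) 6 (\<lambda>i. tensor_power p (s + 1) (sys i))}"
    have "s \<noteq> 0"
    proof
      assume "s = 0"
      from s[unfolded this] have "lin_indep_mod p ({..<0 + 1} \<rightarrow>\<^sub>E Zp3 p) 6 (\<lambda>i. tensor_power p (0 + 1) (sys i))"
        by (rule CollectD)
      with sys_dependent show False by (rule notE)
    qed
    then show "1 \<le> enat s" by (simp add: one_enat_def)
  qed
qed

section \<open>Exact cancellation of the phases along the system\<close>

text \<open>
  The coefficients of the relation
  \<open>N(x + y + z) + N(x + (1 + t) y + (t - 1) z) - N(x + (2 + t) y + t z) = N(x) - 2 N(y) + 2 N(z)\<close>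
  over \<open>\<int>[\<surd>2]\<close>.
\<close>

definition weight :: "nat \<Rightarrow> int" where
  "weight i = (if i = 1 \<or> i = 6 then - 1 else if i = 2 then 2 else if i = 3 then - 2 else 1)"

lemma not_dvd_weight: "\<not> int p dvd weight i"
  using not_dvd_2 p_gt_2 by (auto simp: weight_def)

text \<open>The last three forms map \<open>(box m)\<^sup>3\<close> into \<open>box (7 m)\<close>.\<close>

definition phase_family :: "nat \<Rightarrow> int \<Rightarrow> nat \<Rightarrow> int \<Rightarrow> complex" where
  "phase_family m c i = phase (if i \<le> 3 then m else 7 * m) (weight i) c"

lemma emb_eqI: "int p dvd fst P + snd P * t - x \<Longrightarrow> x mod int p = emb P"
  unfolding emb_def mod_eq_dvd_iff by (rule iffD1[OF dvd_diff_commute])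

text \<open>The first three factors cut out the triples from the small box. On these the last three
  points stay in the large box, and the weighted norms in the exponent add up to 0.\<close>

lemma prod_phase_family_sys:
  assumes m: "32 * (7 * m)\<^sup>2 < p" and xyz: "x \<in> Zp p" "y \<in> Zp p" "z \<in> Zp p"
  shows "(\<Prod>i=1..6. phase_family m c i (sys i (x, y, z)))
    = (if x \<in> emb ` box m \<and> y \<in> emb ` box m \<and> z \<in> emb ` box m then 1 else 0)"
proof (cases "x \<in> emb ` box m \<and> y \<in> emb ` box m \<and> z \<in> emb ` box m")
  case False
  have [simp]: "x mod int p = x" "y mod int p = y" "z mod int p = z"
    using xyz by (auto simp: Zp_def)
  have "sys 1 (x, y, z) = x" "sys 2 (x, y, z) = y" "sys 3 (x, y, z) = z"
    by (simp_all add: sys_def coef_def dot_def)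
  then have "phase_family m c 1 (sys 1 (x, y, z)) = 0 \<or> phase_family m c 2 (sys 2 (x, y, z)) = 0
      \<or> phase_family m c 3 (sys 3 (x, y, z)) = 0"
    using False by (simp add: phase_family_def phase_def) blast
  then have "\<exists>i\<in>{1..6}. phase_family m c i (sys i (x, y, z)) = 0"
    by (simp only: interval_1_6) blast
  then have "(\<Prod>i=1..6. phase_family m c i (sys i (x, y, z))) = 0"
    by (intro prod_zero) simp_all
  with False show ?thesis by auto
next
  case True
  then obtain P Q R where P: "P \<in> box m" "x = emb P" and Q: "Q \<in> box m" "y = emb Q"
    and R: "R \<in> box m" "z = emb R" by blast
  obtain a b where [simp]: "P = (a, b)" by (metis surj_pair)
  obtain a' b' where [simp]: "Q = (a', b')" by (metis surj_pair)
  obtain a'' b'' where [simp]: "R = (a'', b'')" by (metis surj_pair)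
  \<comment> \<open>Lifts of the last three forms, with t acting as (a, b) -> (2b, a). The radius 7m
    comes from the first coordinates of \<open>G\<close> and \<open>H\<close>, whose coefficients
    have absolute sum 7.\<close>
  define F where "F = (a + a' + a'', b + b' + b'')"
  define G where "G = (a + a' + 2 * b' - a'' + 2 * b'', b + a' + b' + a'' - b'')"
  define H where "H = (a + 2 * a' + 2 * b' + 2 * b'', b + a' + 2 * b' + a'')"
  have t2: "int p dvd t\<^sup>2 - 2"
    using t_square by (simp add: cong_iff_dvd_diff)
  have "sys 1 (x, y, z) = emb P" "sys 2 (x, y, z) = emb Q" "sys 3 (x, y, z) = emb R"
    using P Q R by (auto simp: sys_def coef_def dot_def emb_def)
  moreover have "sys 4 (x, y, z) = emb F"
    by (simp add: P Q R sys_def emb_def dot_mod) (simp add: coef_def dot_def F_def algebra_simps)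
  moreover have "sys 5 (x, y, z) = emb G"
  proof -
    have "sys 5 (x, y, z) = (a + b * t + (1 + t) * (a' + b' * t) + (t - 1) * (a'' + b'' * t)) mod int p"
      by (simp add: P Q R sys_def emb_def dot_mod) (simp add: coef_def dot_def)
    also have "\<dots> = emb G"
    proof (rule emb_eqI)
      have "fst G + snd G * t - (a + b * t + (1 + t) * (a' + b' * t) + (t - 1) * (a'' + b'' * t))
        = - (b' + b'') * (t\<^sup>2 - 2)"
        by (simp add: G_def algebra_simps power2_eq_square)
      then show "int p dvd fst G + snd G * t
          - (a + b * t + (1 + t) * (a' + b' * t) + (t - 1) * (a'' + b'' * t))"
        using t2 by (metis dvd_mult)
    qed
    finally show ?thesis .
  qed
  moreover have "sys 6 (x, y, z) = emb H"
  proof -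
    have "sys 6 (x, y, z) = (a + b * t + (2 + t) * (a' + b' * t) + t * (a'' + b'' * t)) mod int p"
      by (simp add: P Q R sys_def emb_def dot_mod) (simp add: coef_def dot_def)
    also have "\<dots> = emb H"
    proof (rule emb_eqI)
      have "fst H + snd H * t - (a + b * t + (2 + t) * (a' + b' * t) + t * (a'' + b'' * t))
        = - (b' + b'') * (t\<^sup>2 - 2)"
        by (simp add: H_def algebra_simps power2_eq_square)
      then show "int p dvd fst H + snd H * t
          - (a + b * t + (2 + t) * (a' + b' * t) + t * (a'' + b'' * t))"
        using t2 by (metis dvd_mult)
    qed
    finally show ?thesis .
  qed
  moreover have "F \<in> box (7 * m)" "G \<in> box (7 * m)" "H \<in> box (7 * m)"
    using P(1) Q(1) R(1) by (auto simp: box_def F_def G_def H_def)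
  moreover have "32 * m\<^sup>2 < p"
    using m by (simp add: power_mult_distrib)
  ultimately have "(\<Prod>i=1..6. phase_family m c i (sys i (x, y, z)))
    = ech p (c * (weight 1 * nrm P)) * (ech p (c * (weight 2 * nrm Q)) * (ech p (c * (weight 3 * nrm R))
      * (ech p (c * (weight 4 * nrm F)) * (ech p (c * (weight 5 * nrm G)) * ech p (c * (weight 6 * nrm H))))))"
    using m P(1) Q(1) R(1) by (simp only: interval_1_6 phase_family_def) (simp add: phase_emb)
  also have "\<dots> = ech p 0"
    unfolding ech_add[symmetric]
    by (rule arg_cong[where f = "ech p"])
      (simp add: weight_def nrm_def F_def G_def H_def power2_eq_square algebra_simps)
  finally show ?thesis
    using True by simp
qed

text \<open>The product is the indicator of a cube, so the average is the cube of the density of the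
  small box, whatever the frequency.\<close>

lemma form_average_phase_family:
  assumes m: "32 * (7 * m)\<^sup>2 < p"
  shows "form_average p 6 sys (phase_family m c) = of_real ((real (2 * m + 1) ^ 2 / real p) ^ 3)"
proof -
  let ?E = "emb ` box m"
  have E: "?E \<subseteq> Zp p" by auto
  have fin: "finite (Zp p)" by (simp add: Zp_def)
  have "(\<Sum>x\<in>Zp p. \<Sum>y\<in>Zp p. \<Sum>z\<in>Zp p. \<Prod>i=1..6. phase_family m c i (sys i (x, y, z)))
    = (\<Sum>x\<in>Zp p. \<Sum>y\<in>Zp p. \<Sum>z\<in>Zp p. of_bool (x \<in> ?E) * of_bool (y \<in> ?E) * of_bool (z \<in> ?E))"
    by (intro sum.cong refl) (simp only: prod_phase_family_sys[OF m], simp)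
  also have "\<dots> = (\<Sum>x\<in>Zp p. of_bool (x \<in> ?E)) ^ 3"
    by (simp add: power3_eq_cube sum_distrib_left sum_distrib_right mult_ac)
  also have "(\<Sum>x\<in>Zp p. of_bool (x \<in> ?E) :: complex) = of_nat (card ?E)"
    using fin E by (simp add: of_bool_def sum.If_cases Int_absorb1 Int_commute)
  also have "card ?E = (2 * m + 1)\<^sup>2"
    using m by (subst card_image[OF inj_on_emb]) (auto simp: card_box power_mult_distrib)
  finally show ?thesis
    by (simp add: form_average_def power_divide)
qed

section \<open>Choice of a frequency\<close>

lemma sum_Re_U2_average_phase_family:
  assumes m: "m \<ge> 1" "10 ^ 4 * m\<^sup>2 \<le> p"
  shows "(\<Sum>c\<in>Zp p. Re (U2_average p (phase_family m c i))) \<le> sqrt p / 6"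
proof -
  define L where "L = (if i \<le> 3 then m else 7 * m)"
  \<comment> \<open>With L at most 7m and m at least 1, the count is at most 2 * 15^2 * 29^3 m^5 =
    10975050 m^5; since m <= sqrt p / 100, this is well below p^(5/2) / 6.\<close>
  have L: "2 * L + 1 \<le> 15 * m" "4 * L + 1 \<le> 29 * m" "L \<le> 7 * m"
    using m by (auto simp: L_def)
  have "L\<^sup>2 \<le> (7 * m)\<^sup>2"
    using L by (intro power_mono) auto
  then have "32 * L\<^sup>2 \<le> 1568 * m\<^sup>2"
    by (simp add: power_mult_distrib)
  moreover have "0 < m\<^sup>2" using m by simp
  moreover have "10000 * m\<^sup>2 \<le> p" using m by simp
  ultimately have L2: "32 * L\<^sup>2 < p"
    by linarith
  have "card (derivs L) \<le> (2 * L + 1) ^ 2 * ((4 * L + 1) ^ 2 + (4 * L + 1) ^ 3)"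
    by (rule card_derivs[OF L2])
  also have "\<dots> \<le> (15 * m) ^ 2 * ((29 * m) ^ 2 + (29 * m) ^ 3)"
    using L by (intro mult_mono add_mono power_mono) auto
  also have "\<dots> \<le> (15 * m) ^ 2 * ((29 * m) ^ 3 + (29 * m) ^ 3)"
    using m by (intro mult_left_mono add_right_mono power_increasing) auto
  also have "(15 * m) ^ 2 * ((29 * m) ^ 3 + (29 * m) ^ 3) = 10975050 * (m ^ 4 * m)"
    by (simp add: power_mult_distrib flip: power_add power_Suc2)
  finally have "real (card (derivs L)) \<le> real (10975050 * (m ^ 4 * m))"
    by (simp only: of_nat_le_iff)
  also have "\<dots> = 10975050 * ((real m ^ 2) ^ 2 * real m)"
    by simp
  also have "\<dots> \<le> 10975050 * ((real p / 10 ^ 4) ^ 2 * (sqrt p / 10 ^ 2))"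
  proof (intro mult_left_mono mult_mono power_mono)
    have "real (10 ^ 4 * m\<^sup>2) \<le> real p" using m(2) by (simp only: of_nat_le_iff)
    then show *: "(real m)\<^sup>2 \<le> real p / 10 ^ 4" by simp
    then have "sqrt ((real m)\<^sup>2) \<le> sqrt (real p / 10 ^ 4)" by (rule real_sqrt_le_mono)
    then show "real m \<le> sqrt p / 10 ^ 2"
      by (simp add: real_sqrt_divide real_sqrt_unique[of 100 10000])
  qed auto
  also have "\<dots> \<le> real p ^ 2 * (sqrt p / 6)"
    by (simp add: power_divide field_simps)
  finally have "real (card (derivs L)) / real p ^ 2 \<le> sqrt p / 6"
    by (simp add: divide_le_eq mult.commute)
  moreover have "(\<Sum>c\<in>Zp p. Re (U2_average p (phase_family m c i))) = real (card (derivs L)) / real p ^ 2"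
  proof -
    have "(\<Sum>c\<in>Zp p. U2_average p (phase_family m c i)) = of_real (real (card (derivs L)) / real p ^ 2)"
      using sum_U2_average_phase[OF L2 not_dvd_weight[of i]] by (simp add: phase_family_def L_def)
    then show ?thesis
      by (metis Re_complex_of_real Re_sum)
  qed
  ultimately show ?thesis by simp
qed

text \<open>The fourth powers of the six norms, summed over functions and frequencies, total at most
  sqrt p. Hence some frequency has sum at most p^(-1/2), and nonnegativity bounds each fourth power
  by the same amount.\<close>

lemma exists_uniform_frequency:
  assumes m: "m \<ge> 1" "10 ^ 4 * m\<^sup>2 \<le> p"
  obtains c where "\<And>j. j \<in> {1..6} \<Longrightarrow> U2_norm p (phase_family m c j) \<le> real p powr (- 1 / 8)"
proof -
  have nonneg: "Re (U2_average p f) = U2_norm p f ^ 4" for f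
    by (metis U2_norm_power4 Re_complex_of_real)
  have "(\<Sum>c\<in>Zp p. \<Sum>i=1..6. Re (U2_average p (phase_family m c i)))
    = (\<Sum>i=1..6. \<Sum>c\<in>Zp p. Re (U2_average p (phase_family m c i)))"
    by (rule sum.swap)
  also have "\<dots> \<le> (\<Sum>i=(1::nat)..6. sqrt p / 6)"
    by (intro sum_mono sum_Re_U2_average_phase_family m)
  also have "\<dots> = (\<Sum>c\<in>Zp p. 1 / sqrt p)"
    by (simp add: Zp_def real_div_sqrt)
  finally have le: "(\<Sum>c\<in>Zp p. \<Sum>i=1..6. Re (U2_average p (phase_family m c i))) \<le> (\<Sum>c\<in>Zp p. 1 / sqrt p)" .
  have "\<exists>c\<in>Zp p. (\<Sum>i=1..6. Re (U2_average p (phase_family m c i))) \<le> 1 / sqrt p"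
  proof (rule ccontr)
    assume "\<not> ?thesis"
    then have "1 / sqrt p < (\<Sum>i=1..6. Re (U2_average p (phase_family m c i)))" if "c \<in> Zp p" for c
      using that by (meson not_le)
    then have "(\<Sum>c\<in>Zp p. 1 / sqrt p) < (\<Sum>c\<in>Zp p. \<Sum>i=1..6. Re (U2_average p (phase_family m c i)))"
      by (rule sum_strict_mono[rotated 2]) (auto simp: Zp_def)
    with leD[OF le] show False by (rule notE)
  qed
  then obtain c where c: "(\<Sum>i=1..6. U2_norm p (phase_family m c i) ^ 4) \<le> 1 / sqrt p"
    unfolding nonneg by blast
  show thesis
  proof
    fix j :: nat assume "j \<in> {1..6}"
    then have "U2_norm p (phase_family m c j) ^ 4 \<le> (\<Sum>i=1..6. U2_norm p (phase_family m c i) ^ 4)"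
      by (intro member_le_sum) auto
    also have "\<dots> \<le> 1 / sqrt p" by (rule c)
    also have "\<dots> = (real p powr (- 1 / 8)) ^ 4"
      by (simp add: powr_power powr_minus powr_half_sqrt divide_simps)
    finally show "U2_norm p (phase_family m c j) \<le> real p powr (- 1 / 8)"
      by (rule power_le_imp_le_base[of _ 3, simplified]) simp
  qed
qed

end

theorem theorem1p7:
  shows "\<exists>N::nat. \<forall>p::nat. p \<ge> N \<longrightarrow> prime p \<longrightarrow>
    ([int p = 1] (mod 8) \<or> [int p = -1] (mod 8)) \<longrightarrow>
    (\<exists>(\<phi> :: nat \<Rightarrow> int \<times> int \<times> int \<Rightarrow> int) (f :: nat \<Rightarrow> int \<Rightarrow> complex).
       (\<forall>i\<in>{1..6}. linear_form p (\<phi> i)) \<and>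
       true_complexity p 6 \<phi> = 1 \<and>
       (\<forall>i\<in>{1..6}. \<forall>x\<in>Zp p. cmod (f i x) \<le> 1) \<and>
       cmod (form_average p 6 \<phi> f) \<ge> 1 / 10 ^ 12 \<and>
       (\<forall>j\<in>{1..6}. U2_norm p (f j) \<le> real p powr (- 1 / 8)))"
\<comment> \<open>From this threshold on sqrt p / 100 is at least 1, so that the box radius
  \<open>m\<close> below is positive.\<close>
proof (intro exI[of _ "10 ^ 4"] allI impI)
  fix p :: nat
  assume p: "10 ^ 4 \<le> p" "prime p" "[int p = 1] (mod 8) \<or> [int p = -1] (mod 8)"
  then have "p > 2" by simp
  obtain t where "[t\<^sup>2 = 2] (mod int p)"
    using two_is_square_mod[OF p(2) \<open>p > 2\<close> p(3)] .
  then interpret sqrt2_mod p t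
    using p \<open>p > 2\<close> by unfold_locales
  define m where "m = nat \<lfloor>sqrt p / 100\<rfloor>"
  have "sqrt (10 ^ 4) \<le> sqrt p"
    using p(1) by (intro real_sqrt_le_mono) (metis of_nat_le_iff of_nat_numeral of_nat_power)
  then have sp: "100 \<le> sqrt p"
    by (simp add: real_sqrt_unique[of 100 10000])
  then have m: "real m \<le> sqrt p / 100" "sqrt p / 100 < real m + 1" "m \<ge> 1"
    unfolding m_def by linarith+
  have "(real m * 100)\<^sup>2 \<le> (sqrt p)\<^sup>2"
    using m by (intro power_mono) auto
  then have "real (10 ^ 4 * m\<^sup>2) \<le> real p"
    by (simp add: power_mult_distrib)
  then have m2: "10 ^ 4 * m\<^sup>2 \<le> p"
    by (simp only: of_nat_le_iff)
  have "0 < m\<^sup>2" "10000 * m\<^sup>2 \<le> p" "32 * (7 * m)\<^sup>2 = 1568 * m\<^sup>2"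
    using m(3) m2 by (auto simp: power_mult_distrib)
  then have m3: "32 * (7 * m)\<^sup>2 < p"
    by linarith
  obtain c where c: "\<And>j. j \<in> {1..6} \<Longrightarrow> U2_norm p (phase_family m c j) \<le> real p powr (- 1 / 8)"
    using exists_uniform_frequency[OF m(3) m2] by blast
  \<comment> \<open>The small box thus has density at least 10^(-4) in F_p, whose cube is the
    constant 10^(-12).\<close>
  have "sqrt p / 100 \<le> real (2 * m + 1)"
    using sp m(2) by simp
  then have "(sqrt p / 100)\<^sup>2 \<le> real (2 * m + 1) ^ 2"
    by (intro power_mono) auto
  then have "1 / 10 ^ 4 \<le> real (2 * m + 1) ^ 2 / real p"
    by (simp add: power_divide field_simps)
  then have "(1 / 10 ^ 4) ^ 3 \<le> (real (2 * m + 1) ^ 2 / real p) ^ 3"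
    by (intro power_mono) auto
  then have "1 / 10 ^ 12 \<le> cmod (form_average p 6 sys (phase_family m c))"
    unfolding form_average_phase_family[OF m3] norm_of_real by (simp add: power_divide)
  then show "\<exists>(\<phi> :: nat \<Rightarrow> int \<times> int \<times> int \<Rightarrow> int) (f :: nat \<Rightarrow> int \<Rightarrow> complex).
       (\<forall>i\<in>{1..6}. linear_form p (\<phi> i)) \<and>
       true_complexity p 6 \<phi> = 1 \<and>
       (\<forall>i\<in>{1..6}. \<forall>x\<in>Zp p. cmod (f i x) \<le> 1) \<and>
       cmod (form_average p 6 \<phi> f) \<ge> 1 / 10 ^ 12 \<and>
       (\<forall>j\<in>{1..6}. U2_norm p (f j) \<le> real p powr (- 1 / 8))"
    using linear_form_sys true_complexity_sys c
    by (intro exI[of _ sys] exI[of _ "phase_family m c"]) (auto simp: phase_family_def norm_phase)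
qed

end
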